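(* Let $R$ be a commutative Noetherian ring, let $M$ be an $R$-module, and let $\mathcal{L}$ be a nonempty subclass of $\mathcal{M}$ satisfying conditions $(\alpha)$ and $(\mu)$. Then $M$ is $\mathcal{L}$-injective if and only if for every $(R,I,f,M)\in\mathcal{L}$ with $I$ a prime ideal of $R$, the homomorphism $f$ extends to a homomorphism from $R$ to $M$.
   Context: Rings are associative with nonzero identity; all modules are unital (left) $R$-modules; $N\leq M$ means $N$ is a submodule of $M$. $\mathcal{M}$ is the class of all quadruples $(M,N,f,Q)$ with $M,N,Q$ $R$-modules, $N\leq M$ and $f\in\mathrm{Hom}_R(N,Q)$. For a nonempty subclass $\mathcal{L}\subseteq\mathcal{M}$, a module $Q$ is called $\mathcal{L}$-injective if for each $(B,A,f,Q)\in\mathcal{L}$ (that is, each element of $\mathcal{L}$ with last entry $Q$) there is a homomorphism $g:B\to Q$ with $g(a)=f(a)$ for all $a\in A$. For $N\leq M$ and $x\in M$, $(N:x)=\{r\in R\mid rx\in N\}$. Conditions on $\mathcal{L}$: $(\alpha)$: if $(M,N,f,Q)\in\mathcal{L}$, $(M,N',f',Q)\in\mathcal{M}$, $N\subseteq N'$ and $f'|_N=f$, then $(M,N',f',Q)\in\mathcal{L}$. $(\mu)$: if $(M,N,f,Q)\in\mathcal{L}$, then for all $x\in M$, $(R,(N:x),f_x,Q)\in\mathcal{L}$, where $f_x:(N:x)\to Q$ is given by $f_x(r)=f(rx)$. *)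

theory Defs
  imports "HOL-Algebra.Module" "HOL-Algebra.Ideal" "HOL-Algebra.Ring_Divisibility"
    "HOL-Library.FuncSet"
begin

text \<open>
  The type variable \<open>'u\<close> plays the role of a universe: the carriers of the ring and of all modules
  under consideration are subsets of \<open>'u\<close>. In this way the regular module of the ring is one of
  the modules that a class of quadruples can talk about, while modules may be of any cardinality
  (that of \<open>'u\<close> is unconstrained). The locale \<open>module\<close> of the library presupposes a commutative
  ring.
\<close>

text \<open>The fields \<open>mult\<close> and \<open>one\<close> of a module record are not constrained by the locale \<open>module\<close>
  and carry no meaning; below they are filled with those of the ring.\<close>

definition regular_module :: "('u, 'r) ring_scheme \<Rightarrow> ('u, 'u) module" where
  "regular_module R =
     \<lparr>carrier = carrier R, monoid.mult = monoid.mult R, one = one R,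
      zero = zero R, add = add R, smult = monoid.mult R\<rparr>"

text \<open>Homomorphisms are extensional functions, so that equality of homomorphisms in HOL is
  equality of maps on the carrier of the domain.\<close>

definition module_Hom ::
  "('u, 'r) ring_scheme \<Rightarrow> ('u, 'u) module \<Rightarrow> ('u, 'u) module \<Rightarrow> ('u \<Rightarrow> 'u) set" where
  "module_Hom R M N =
     {f \<in> carrier M \<rightarrow>\<^sub>E carrier N.
        (\<forall>x\<in>carrier M. \<forall>y\<in>carrier M. f (x \<oplus>\<^bsub>M\<^esub> y) = f x \<oplus>\<^bsub>N\<^esub> f y) \<and>
        (\<forall>r\<in>carrier R. \<forall>x\<in>carrier M. f (r \<odot>\<^bsub>M\<^esub> x) = r \<odot>\<^bsub>N\<^esub> f x)}"

type_synonym 'u quadruple = "('u, 'u) module \<times> 'u set \<times> ('u \<Rightarrow> 'u) \<times> ('u, 'u) module"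

definition all_quadruples :: "('u, 'r) ring_scheme \<Rightarrow> 'u quadruple set" where
  "all_quadruples R =
     {(M, N, f, Q). module R M \<and> module R Q \<and> submodule N R M \<and>
        f \<in> module_Hom R (M\<lparr>carrier := N\<rparr>) Q}"

definition L_injective ::
  "('u, 'r) ring_scheme \<Rightarrow> 'u quadruple set \<Rightarrow> ('u, 'u) module \<Rightarrow> bool" where
  "L_injective R L Q \<longleftrightarrow>
     (\<forall>B A f. (B, A, f, Q) \<in> L \<longrightarrow> (\<exists>g\<in>module_Hom R B Q. \<forall>a\<in>A. g a = f a))"

definition colon :: "('u, 'r) ring_scheme \<Rightarrow> ('u, 'u) module \<Rightarrow> 'u set \<Rightarrow> 'u \<Rightarrow> 'u set" where
  "colon R M N x = {r \<in> carrier R. r \<odot>\<^bsub>M\<^esub> x \<in> N}"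

definition condition_alpha :: "('u, 'r) ring_scheme \<Rightarrow> 'u quadruple set \<Rightarrow> bool" where
  "condition_alpha R L \<longleftrightarrow>
     (\<forall>M N f Q N' f'. (M, N, f, Q) \<in> L \<longrightarrow> (M, N', f', Q) \<in> all_quadruples R \<longrightarrow>
        N \<subseteq> N' \<longrightarrow> restrict f' N = f \<longrightarrow> (M, N', f', Q) \<in> L)"

definition condition_mu :: "('u, 'r) ring_scheme \<Rightarrow> 'u quadruple set \<Rightarrow> bool" where
  "condition_mu R L \<longleftrightarrow>
     (\<forall>M N f Q. (M, N, f, Q) \<in> L \<longrightarrow>
        (\<forall>x\<in>carrier M.
           (regular_module R, colon R M N x, \<lambda>r\<in>colon R M N x. f (r \<odot>\<^bsub>M\<^esub> x), Q) \<in> L))"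

lemma (in cring) regular_module_module: "module R (regular_module R)"
proof -
  have "abelian_group (regular_module R)"
    by (rule abelian_groupI)
      (auto simp: regular_module_def a_ac intro: add.l_inv_ex)
  then show ?thesis
    by (intro moduleI) (auto simp: regular_module_def l_distr r_distr m_assoc is_cring)
qed

end

theory Submission
  imports Defs
begin

text \<open>
  By Zorn's lemma a homomorphism of \<open>L\<close> into \<open>M\<close> has a maximal partial extension \<open>h\<close>, defined on
  some \<open>C \<le> B\<close>, which is again in \<open>L\<close> by \<open>(\<alpha>)\<close>. If \<open>C \<noteq> B\<close>, the Noetherian condition yields
  \<open>x \<in> B - C\<close> with \<open>(C : x)\<close> maximal among the ideals \<open>(C : y)\<close>, \<open>y \<in> B - C\<close>; such an ideal is
  prime (it is an associated prime of \<open>B / C\<close>). By \<open>(\<mu>)\<close> and the hypothesis on prime ideals,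
  \<open>r \<mapsto> h (r x)\<close> extends to some \<open>g\<close> on \<open>R\<close>, and mapping \<open>x\<close> to \<open>g 1\<close> extends \<open>h\<close> to \<open>C + R x\<close>,
  contradicting maximality.
\<close>

section \<open>Maximal ideals of a family and primality of maximal colon ideals\<close>

text \<open>In a Noetherian ring a nonempty chain of ideals has its union as a member. Hence upper
  bounds for Zorn's lemma lie in \<open>A\<close>, whatever family of ideals \<open>A\<close>
  is.\<close>

lemma (in noetherian_ring) exists_maximal_ideal_in:
  assumes "A \<noteq> {}" and "\<And>I. I \<in> A \<Longrightarrow> ideal I R"
  shows "\<exists>I\<in>A. \<forall>J\<in>A. I \<subseteq> J \<longrightarrow> J = I"
proof (rule subset_Zorn_nonempty)
  fix C assume C: "C \<noteq> {}" "subset.chain A C"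
  then have "subset.chain {I. ideal I R} C"
    using assms(2) by (auto simp: subset_chain_def)
  then have "\<Union>C \<in> C"
    using ideal_chain_is_trivial C(1) by blast
  then show "\<Union>C \<in> A"
    using C(2) by (auto simp: subset_chain_def)
qed (fact assms(1))

lemma ideal_colon:
  fixes R (structure)
  assumes "module R M" and N: "submodule N R M" and x: "x \<in> carrier M"
  shows "ideal (colon R M N x) R"
proof (rule idealI)
  interpret module R M by fact
  note N' = submoduleE[OF N]
  have zero: "\<zero>\<^bsub>M\<^esub> \<in> N"
    using N'(1,2,4) smult_l_null by (metis R.zero_closed ex_in_conv subsetD)
  show "ring R" by (rule R.ring_axioms)
  show "subgroup (colon R M N x) (add_monoid R)"
    by (rule R.add.subgroupI)
      (use x zero N' in \<open>auto simp: colon_def smult_l_distr smult_l_minus simp flip: a_inv_def\<close>)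
  show "r \<otimes> a \<in> colon R M N x" "a \<otimes> r \<in> colon R M N x"
    if "a \<in> colon R M N x" "r \<in> carrier R" for a r
    using that x N'(4) by (auto simp: colon_def smult_assoc1 R.m_comm[of a r])
qed

text \<open>If \<open>b\<close> is outside \<open>(N : x)\<close>, then \<open>b x\<close> is
  outside \<open>N\<close>, and commutativity gives that \<open>(N : x)\<close> lies in
  \<open>(N : b x)\<close>. Maximality makes the two equal, and \<open>a b x\<close> in
  \<open>N\<close> says that \<open>a\<close> belongs to the latter.\<close>

lemma primeideal_colon_maximal:
  fixes R (structure)
  assumes M: "module R M" and N: "submodule N R M" and x: "x \<in> carrier M" "x \<notin> N"
    and max: "\<And>y. y \<in> carrier M \<Longrightarrow> y \<notin> N \<Longrightarrow> colon R M N x \<subseteq> colon R M N y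
                \<Longrightarrow> colon R M N y = colon R M N x"
  shows "primeideal (colon R M N x) R"
proof (rule primeidealI)
  interpret module R M by (fact M)
  show "ideal (colon R M N x) R" by (rule ideal_colon[OF M N x(1)])
  show "cring R" by (rule R.is_cring)
  have "\<one> \<notin> colon R M N x" using x by (simp add: colon_def)
  then show "carrier R \<noteq> colon R M N x" by auto
  fix a b assume ab: "a \<in> carrier R" "b \<in> carrier R" "a \<otimes> b \<in> colon R M N x"
  show "a \<in> colon R M N x \<or> b \<in> colon R M N x"
  proof (rule disjCI)
    assume b: "b \<notin> colon R M N x"
    have "colon R M N x \<subseteq> colon R M N (b \<odot>\<^bsub>M\<^esub> x)"
    proof
      fix r assume r: "r \<in> colon R M N x"
      then have "r \<odot>\<^bsub>M\<^esub> (b \<odot>\<^bsub>M\<^esub> x) = b \<odot>\<^bsub>M\<^esub> (r \<odot>\<^bsub>M\<^esub> x)"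
        using ab x by (simp add: colon_def R.m_comm flip: smult_assoc1)
      then show "r \<in> colon R M N (b \<odot>\<^bsub>M\<^esub> x)"
        using r ab submoduleE(4)[OF N] by (simp add: colon_def)
    qed
    then have "colon R M N (b \<odot>\<^bsub>M\<^esub> x) = colon R M N x"
      using max[of "b \<odot>\<^bsub>M\<^esub> x"] b ab x by (simp add: colon_def)
    moreover have "a \<in> colon R M N (b \<odot>\<^bsub>M\<^esub> x)"
      using ab x by (simp add: colon_def smult_assoc1)
    ultimately show "a \<in> colon R M N x" by simp
  qed
qed

section \<open>Partial homomorphisms as graphs\<close>

text \<open>A linear graph is the graph of a homomorphism from a submodule of \<open>B\<close> to \<open>Q\<close>; given
  linearity, triviality of the fibre over \<open>0\<close> makes it single-valued.\<close>

definition linear_graph ::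
  "('r, 'm) ring_scheme \<Rightarrow> ('r, 'b, 'n) module_scheme \<Rightarrow> ('r, 'q, 'k) module_scheme
    \<Rightarrow> ('b \<times> 'q) set \<Rightarrow> bool" where
  "linear_graph R B Q G \<longleftrightarrow>
     G \<subseteq> carrier B \<times> carrier Q \<and> (\<zero>\<^bsub>B\<^esub>, \<zero>\<^bsub>Q\<^esub>) \<in> G \<and>
     (\<forall>x y x' y'. (x, y) \<in> G \<longrightarrow> (x', y') \<in> G \<longrightarrow> (x \<oplus>\<^bsub>B\<^esub> x', y \<oplus>\<^bsub>Q\<^esub> y') \<in> G) \<and>
     (\<forall>r\<in>carrier R. \<forall>x y. (x, y) \<in> G \<longrightarrow> (r \<odot>\<^bsub>B\<^esub> x, r \<odot>\<^bsub>Q\<^esub> y) \<in> G) \<and>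
     (\<forall>y. (\<zero>\<^bsub>B\<^esub>, y) \<in> G \<longrightarrow> y = \<zero>\<^bsub>Q\<^esub>)"

lemma linear_graphD:
  assumes "linear_graph R B Q G"
  shows "(x, y) \<in> G \<Longrightarrow> x \<in> carrier B" "(x, y) \<in> G \<Longrightarrow> y \<in> carrier Q"
    and "(\<zero>\<^bsub>B\<^esub>, \<zero>\<^bsub>Q\<^esub>) \<in> G"
    and "(x, y) \<in> G \<Longrightarrow> (x', y') \<in> G \<Longrightarrow> (x \<oplus>\<^bsub>B\<^esub> x', y \<oplus>\<^bsub>Q\<^esub> y') \<in> G"
    and "r \<in> carrier R \<Longrightarrow> (x, y) \<in> G \<Longrightarrow> (r \<odot>\<^bsub>B\<^esub> x, r \<odot>\<^bsub>Q\<^esub> y) \<in> G"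
    and "(\<zero>\<^bsub>B\<^esub>, y) \<in> G \<Longrightarrow> y = \<zero>\<^bsub>Q\<^esub>"
  using assms unfolding linear_graph_def by blast+

text \<open>This supplies the upper bounds for Zorn's lemma. Only closure under addition involves
  two pairs at once; the chain property puts both into a single member.\<close>

lemma linear_graph_Union_chain:
  assumes "C \<noteq> {}" and chain: "subset.chain {G. linear_graph R B Q G} C"
  shows "linear_graph R B Q (\<Union>C)"
proof -
  have lin: "linear_graph R B Q G" if "G \<in> C" for G
    using that chain by (auto simp: subset_chain_def)
  have "(x \<oplus>\<^bsub>B\<^esub> x', y \<oplus>\<^bsub>Q\<^esub> y') \<in> \<Union>C"
    if xy: "(x, y) \<in> \<Union>C" "(x', y') \<in> \<Union>C" for x y x' y'
  proof -
    obtain G G' where G: "G \<in> C" "G' \<in> C" "(x, y) \<in> G" "(x', y') \<in> G'"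
      using xy by blast
    then have "G \<subseteq> G' \<or> G' \<subseteq> G"
      using chain by (simp add: subset_chain_def)
    then obtain H where "H \<in> C" "(x, y) \<in> H" "(x', y') \<in> H"
      using G by blast
    then show ?thesis using linear_graphD(4)[OF lin] by blast
  qed
  then have add: "\<forall>x y x' y'. (x, y) \<in> \<Union>C \<longrightarrow> (x', y') \<in> \<Union>C
      \<longrightarrow> (x \<oplus>\<^bsub>B\<^esub> x', y \<oplus>\<^bsub>Q\<^esub> y') \<in> \<Union>C"
    by blast
  show ?thesis
    unfolding linear_graph_def
  proof (intro conjI)
    show "\<Union>C \<subseteq> carrier B \<times> carrier Q"
      using linear_graphD(1,2)[OF lin] by auto
    show "(\<zero>\<^bsub>B\<^esub>, \<zero>\<^bsub>Q\<^esub>) \<in> \<Union>C"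
      using assms(1) linear_graphD(3)[OF lin] by blast
    show "\<forall>r\<in>carrier R. \<forall>x y. (x, y) \<in> \<Union>C \<longrightarrow> (r \<odot>\<^bsub>B\<^esub> x, r \<odot>\<^bsub>Q\<^esub> y) \<in> \<Union>C"
      using linear_graphD(5)[OF lin] by blast
    show "\<forall>y. (\<zero>\<^bsub>B\<^esub>, y) \<in> \<Union>C \<longrightarrow> y = \<zero>\<^bsub>Q\<^esub>"
      using linear_graphD(6)[OF lin] by blast
  qed (fact add)
qed

locale module_pair = B: module R B + Q: module R Q
  for R (structure) and B :: "('r, 'b, 'n) module_scheme" and Q :: "('r, 'q, 'k) module_scheme"
begin

lemma linear_graph_unique:
  assumes G: "linear_graph R B Q G" and "(x, y) \<in> G" "(x, y') \<in> G"
  shows "y = y'"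
proof -
  note D = linear_graphD[OF G]
  have c: "x \<in> carrier B" "y \<in> carrier Q" "y' \<in> carrier Q"
    using assms D(1,2) by blast+
  \<comment> \<open>Subtracting the two pairs, with negation expressed as scaling by
    \<open>-1\<close>, leaves a pair over zero.\<close>
  have "(x \<oplus>\<^bsub>B\<^esub> (\<ominus> \<one>) \<odot>\<^bsub>B\<^esub> x, y \<oplus>\<^bsub>Q\<^esub> (\<ominus> \<one>) \<odot>\<^bsub>Q\<^esub> y') \<in> G"
    using assms D(4,5) by simp
  then have "(\<zero>\<^bsub>B\<^esub>, y \<ominus>\<^bsub>Q\<^esub> y') \<in> G"
    using c by (simp add: B.smult_l_minus Q.smult_l_minus B.M.r_neg a_minus_def)
  then have "y \<ominus>\<^bsub>Q\<^esub> y' = \<zero>\<^bsub>Q\<^esub>"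
    using D(6) by blast
  then show ?thesis
    using Q.M.minus_equality[of y "\<ominus>\<^bsub>Q\<^esub> y'"] c by (simp add: a_minus_def)
qed

lemma linear_graph_of_Hom:
  assumes N: "submodule N R B"
    and f: "f \<in> N \<rightarrow> carrier Q"
      "\<And>x y. x \<in> N \<Longrightarrow> y \<in> N \<Longrightarrow> f (x \<oplus>\<^bsub>B\<^esub> y) = f x \<oplus>\<^bsub>Q\<^esub> f y"
      "\<And>r x. r \<in> carrier R \<Longrightarrow> x \<in> N \<Longrightarrow> f (r \<odot>\<^bsub>B\<^esub> x) = r \<odot>\<^bsub>Q\<^esub> f x"
  shows "linear_graph R B Q ((\<lambda>x. (x, f x)) ` N)"
proof -
  note N' = B.submoduleE[OF N]
  \<comment> \<open>Scaling any element of \<open>N\<close> by the zero of \<open>R\<close> yields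
    both that zero lies in \<open>N\<close> and that \<open>f\<close> preserves it.\<close>
  obtain n where "n \<in> N" using N'(2) by blast
  then have "\<zero> \<odot>\<^bsub>B\<^esub> n = \<zero>\<^bsub>B\<^esub>" "\<zero> \<odot>\<^bsub>B\<^esub> n \<in> N" "f (\<zero> \<odot>\<^bsub>B\<^esub> n) = \<zero> \<odot>\<^bsub>Q\<^esub> f n" "f n \<in> carrier Q"
    using N' f by auto
  then have "\<zero>\<^bsub>B\<^esub> \<in> N" "f \<zero>\<^bsub>B\<^esub> = \<zero>\<^bsub>Q\<^esub>"
    by simp_all
  then show ?thesis
    using N' f unfolding linear_graph_def by (auto simp: image_iff)
qed

lemma submodule_Domain_linear_graph:
  assumes G: "linear_graph R B Q G"
  shows "submodule (Domain G) R B"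
proof (rule B.submoduleI)
  note D = linear_graphD[OF G]
  show smult: "r \<odot>\<^bsub>B\<^esub> x \<in> Domain G" if "r \<in> carrier R" "x \<in> Domain G" for r x
    using D(5) that by blast
  show "Domain G \<subseteq> carrier B" "\<zero>\<^bsub>B\<^esub> \<in> Domain G"
    using D(1,3) by blast+
  show "x \<oplus>\<^bsub>B\<^esub> y \<in> Domain G" if "x \<in> Domain G" "y \<in> Domain G" for x y
    using D(4) that by blast
  show "\<ominus>\<^bsub>B\<^esub> x \<in> Domain G" if "x \<in> Domain G" for x
    using smult[of "\<ominus> \<one>" x] that D(1) by (auto simp: B.smult_l_minus)
qed

text \<open>This leads back from graphs to functions; \<open>h\<close> is extensional because
  \<open>module_Hom\<close> contains only extensional maps.\<close>

lemma linear_graph_fun: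
  assumes G: "linear_graph R B Q G"
  obtains h where "h \<in> extensional (Domain G)" "\<And>x. x \<in> Domain G \<Longrightarrow> (x, h x) \<in> G"
    "\<And>x y. (x, y) \<in> G \<Longrightarrow> h x = y"
proof
  let ?h = "\<lambda>x\<in>Domain G. THE y. (x, y) \<in> G"
  have the: "(THE y. (x, y) \<in> G) = y" if "(x, y) \<in> G" for x y
    using that linear_graph_unique[OF G] by blast
  then show "(x, ?h x) \<in> G" if "x \<in> Domain G" for x
    using that by auto
  show "?h x = y" if "(x, y) \<in> G" for x y
    using that the by auto
  show "?h \<in> extensional (Domain G)" by (rule restrict_extensional)
qed

text \<open>The new graph is the sum of \<open>G\<close> and the cyclic submodule generated by
  \<open>(x, m)\<close>. The condition \<open>compat\<close> says that sending \<open>x\<close> to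
  \<open>m\<close> agrees with \<open>G\<close> on those multiples of \<open>x\<close> that are
  already in its domain.\<close>

lemma linear_graph_adjoin:
  assumes G: "linear_graph R B Q G" and x: "x \<in> carrier B" and m: "m \<in> carrier Q"
    and compat: "\<And>r. r \<in> carrier R \<Longrightarrow> r \<odot>\<^bsub>B\<^esub> x \<in> Domain G \<Longrightarrow> (r \<odot>\<^bsub>B\<^esub> x, r \<odot>\<^bsub>Q\<^esub> m) \<in> G"
  obtains G' where "linear_graph R B Q G'" "G \<subseteq> G'" "(x, m) \<in> G'"
proof
  note D = linear_graphD[OF G]
  let ?p = "\<lambda>c y r. (c \<oplus>\<^bsub>B\<^esub> r \<odot>\<^bsub>B\<^esub> x, y \<oplus>\<^bsub>Q\<^esub> r \<odot>\<^bsub>Q\<^esub> m)"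
  define G' where "G' = {?p c y r |c y r. (c, y) \<in> G \<and> r \<in> carrier R}"
  have I: "p \<in> G'" if "(c, y) \<in> G" "r \<in> carrier R" "p = ?p c y r" for p c y r
    using that unfolding G'_def by blast
  show sub: "G \<subseteq> G'"
  proof clarify
    fix c y assume "(c, y) \<in> G"
    then show "(c, y) \<in> G'"
      using D(1,2) x m by (intro I[of c y \<zero>]) auto
  qed
  show "(x, m) \<in> G'"
    using D(3) x m by (intro I[of "\<zero>\<^bsub>B\<^esub>" "\<zero>\<^bsub>Q\<^esub>" \<one>]) auto
  have add: "(u \<oplus>\<^bsub>B\<^esub> u', v \<oplus>\<^bsub>Q\<^esub> v') \<in> G'" if uv: "(u, v) \<in> G'" "(u', v') \<in> G'" for u v u' v'
  proof -
    obtain c y r c' y' r' where *: "(c, y) \<in> G" "r \<in> carrier R" "(u, v) = ?p c y r"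
      "(c', y') \<in> G" "r' \<in> carrier R" "(u', v') = ?p c' y' r'"
      using uv unfolding G'_def by blast
    then have "c \<in> carrier B" "c' \<in> carrier B" "y \<in> carrier Q" "y' \<in> carrier Q"
      using D(1,2) by blast+
    then show ?thesis
      using * x m by (intro I[OF D(4)[OF *(1,4)], of "r \<oplus> r'"])
        (auto simp: B.smult_l_distr Q.smult_l_distr B.M.a_ac Q.M.a_ac)
  qed
  have smult: "(s \<odot>\<^bsub>B\<^esub> u, s \<odot>\<^bsub>Q\<^esub> v) \<in> G'" if s: "s \<in> carrier R" and uv: "(u, v) \<in> G'" for s u v
  proof -
    obtain c y r where *: "(c, y) \<in> G" "r \<in> carrier R" "(u, v) = ?p c y r"
      using uv unfolding G'_def by blast
    then have "c \<in> carrier B" "y \<in> carrier Q"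
      using D(1,2) by blast+
    then show ?thesis
      using * x m s by (intro I[OF D(5)[OF s *(1)], of "s \<otimes> r"])
        (auto simp: B.smult_r_distr Q.smult_r_distr B.smult_assoc1 Q.smult_assoc1)
  qed
  have zero: "v = \<zero>\<^bsub>Q\<^esub>" if v: "(\<zero>\<^bsub>B\<^esub>, v) \<in> G'" for v
  proof -
    obtain c y r where *: "(c, y) \<in> G" "r \<in> carrier R"
      "\<zero>\<^bsub>B\<^esub> = c \<oplus>\<^bsub>B\<^esub> r \<odot>\<^bsub>B\<^esub> x" "v = y \<oplus>\<^bsub>Q\<^esub> r \<odot>\<^bsub>Q\<^esub> m"
      using v unfolding G'_def by blast
    then have c: "c \<in> carrier B" "y \<in> carrier Q"
      using D(1,2) by blast+
    \<comment> \<open>A relation \<open>c + r x = 0\<close> puts \<open>r x\<close> into the domain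
      of \<open>G\<close>, so \<open>compat\<close> applies and the pair over zero already lies in
      \<open>G\<close>.\<close>
    have "r \<odot>\<^bsub>B\<^esub> x = \<ominus>\<^bsub>B\<^esub> c"
      using *(2,3) c x by (metis B.M.minus_equality B.M.a_comm B.smult_closed)
    then have "r \<odot>\<^bsub>B\<^esub> x \<in> Domain G"
      using *(1) B.submoduleE(3)[OF submodule_Domain_linear_graph[OF G]] by auto
    then have "(r \<odot>\<^bsub>B\<^esub> x, r \<odot>\<^bsub>Q\<^esub> m) \<in> G"
      using compat *(2) by blast
    then have "(\<zero>\<^bsub>B\<^esub>, v) \<in> G"
      using D(4)[OF *(1)] *(3,4) by simp
    then show ?thesis using D(6) by blast
  qed
  have "G' \<subseteq> carrier B \<times> carrier Q"
    using D(1,2) x m by (fastforce simp: G'_def)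
  then show "linear_graph R B Q G'"
    unfolding linear_graph_def using add smult zero sub D(3) by blast
qed

end

section \<open>Reduction of injectivity to prime ideals\<close>

theorem theorem2p8:
  fixes R :: "('u, 'r) ring_scheme" and M :: "('u, 'u) module" and L :: "'u quadruple set"
  assumes "cring R" and "\<one>\<^bsub>R\<^esub> \<noteq> \<zero>\<^bsub>R\<^esub>" and "noetherian_ring R"
    and "module R M"
    and "L \<noteq> {}" and "L \<subseteq> all_quadruples R"
    and "condition_alpha R L" and "condition_mu R L"
  shows "L_injective R L M \<longleftrightarrow>
    (\<forall>I f. primeideal I R \<longrightarrow> (regular_module R, I, f, M) \<in> L \<longrightarrow>
       (\<exists>g\<in>module_Hom R (regular_module R) M. \<forall>a\<in>I. g a = f a))"
proof
  assume "L_injective R L M"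
  then show "\<forall>I f. primeideal I R \<longrightarrow> (regular_module R, I, f, M) \<in> L \<longrightarrow>
       (\<exists>g\<in>module_Hom R (regular_module R) M. \<forall>a\<in>I. g a = f a)"
    unfolding L_injective_def by blast
next
  assume prime_ext: "\<forall>I f. primeideal I R \<longrightarrow> (regular_module R, I, f, M) \<in> L \<longrightarrow>
       (\<exists>g\<in>module_Hom R (regular_module R) M. \<forall>a\<in>I. g a = f a)"
  show "L_injective R L M"
    unfolding L_injective_def
  proof (intro allI impI)
    fix B A f assume L: "(B, A, f, M) \<in> L"
    then have "module R B" and A: "submodule A R B" and f: "f \<in> module_Hom R (B\<lparr>carrier := A\<rparr>) M"
      using assms(6) by (auto simp: all_quadruples_def)
    interpret module_pair R B M
      using \<open>module R B\<close> \<open>module R M\<close> by (rule module_pair.intro)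
    interpret noetherian_ring R by fact
    let ?G0 = "(\<lambda>x. (x, f x)) ` A"
    \<comment> \<open>For graphs, extending a partial homomorphism is plain inclusion, so Zorn's
      lemma for sets applies.\<close>
    let ?S = "{G. linear_graph R B M G \<and> ?G0 \<subseteq> G}"
    have "linear_graph R B M ?G0"
      using f by (intro linear_graph_of_Hom[OF A]) (auto simp: module_Hom_def)
    then have "?S \<noteq> {}" by blast
    moreover have "\<Union>C \<in> ?S" if "C \<noteq> {}" "subset.chain ?S C" for C
      using that linear_graph_Union_chain[of C R B M] by (auto simp: subset_chain_def)
    ultimately have "\<exists>G\<in>?S. \<forall>X\<in>?S. G \<subseteq> X \<longrightarrow> X = G"
      by (rule subset_Zorn_nonempty)
    \<comment> \<open>A linear graph above \<open>G\<close> also contains \<open>?G0\<close>, so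
      \<open>G\<close> is maximal among all linear graphs.\<close>
    then obtain G where G: "linear_graph R B M G" "?G0 \<subseteq> G"
      and max: "\<And>X. linear_graph R B M X \<Longrightarrow> G \<subseteq> X \<Longrightarrow> X = G"
      by (auto dest: order_trans)
    note D = linear_graphD[OF G(1)]
    let ?C = "Domain G"
    have C: "submodule ?C R B" by (rule submodule_Domain_linear_graph[OF G(1)])
    obtain h where h: "h \<in> extensional ?C" "\<And>x. x \<in> ?C \<Longrightarrow> (x, h x) \<in> G"
      "\<And>x y. (x, y) \<in> G \<Longrightarrow> h x = y"
      using linear_graph_fun[OF G(1)] by blast
    have h_f: "h a = f a" if "a \<in> A" for a
      using that G(2) h(3) by blast
    have h_Hom: "h \<in> module_Hom R (B\<lparr>carrier := ?C\<rparr>) M"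
      using h D(2,4,5) unfolding module_Hom_def PiE_def
      by (auto intro!: h(3) simp del: Domain_iff)
    have "A \<subseteq> ?C" using G(2) by blast
    \<comment> \<open>This is an equality of total functions, as \<open>condition_alpha\<close>
      demands; off \<open>A\<close> it holds because \<open>f\<close> is extensional.\<close>
    moreover have "restrict h A = f"
      using f h_f by (auto simp: module_Hom_def PiE_def extensional_def)
    moreover have "(B, ?C, h, M) \<in> all_quadruples R"
      using \<open>module R B\<close> \<open>module R M\<close> C h_Hom by (simp add: all_quadruples_def)
    ultimately have hL: "(B, ?C, h, M) \<in> L"
      using assms(7) L unfolding condition_alpha_def by blast
    have "?C = carrier B"
    proof (rule ccontr)
      assume "?C \<noteq> carrier B"
      then have "carrier B - ?C \<noteq> {}"
        using D(1) by blast
      then have "\<exists>I\<in>colon R B ?C ` (carrier B - ?C). \<forall>J\<in>colon R B ?C ` (carrier B - ?C).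
                    I \<subseteq> J \<longrightarrow> J = I"
        by (intro exists_maximal_ideal_in) (auto intro: ideal_colon[OF \<open>module R B\<close> C])
      then obtain x where "x \<in> carrier B - ?C"
        and "\<forall>J\<in>colon R B ?C ` (carrier B - ?C). colon R B ?C x \<subseteq> J \<longrightarrow> J = colon R B ?C x"
        by (elim bexE imageE) simp
      \<comment> \<open>Maximality among the ideals is restated for points, the form that the
        primality lemma takes.\<close>
      then have x: "x \<in> carrier B" "x \<notin> ?C"
        and x_max: "\<And>y. y \<in> carrier B \<Longrightarrow> y \<notin> ?C \<Longrightarrow> colon R B ?C x \<subseteq> colon R B ?C y
                      \<Longrightarrow> colon R B ?C y = colon R B ?C x"
        by (simp_all only: Diff_iff ball_simps simp_thms)
      let ?I = "colon R B ?C x"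
      have "primeideal ?I R"
        by (rule primeideal_colon_maximal[OF \<open>module R B\<close> C x x_max])
      moreover have "(regular_module R, ?I, \<lambda>r\<in>?I. h (r \<odot>\<^bsub>B\<^esub> x), M) \<in> L"
        using assms(8) hL x(1) unfolding condition_mu_def by blast
      ultimately obtain g where g: "g \<in> module_Hom R (regular_module R) M"
        and gh: "\<And>r. r \<in> ?I \<Longrightarrow> g r = h (r \<odot>\<^bsub>B\<^esub> x)"
        using prime_ext by fastforce
      have g1: "g \<one>\<^bsub>R\<^esub> \<in> carrier M"
        using g by (auto simp: module_Hom_def regular_module_def)
      \<comment> \<open>A homomorphism on the regular module is determined by its value at one,
        which becomes the image of \<open>x\<close>.\<close>
      have g_smult: "g r = r \<odot>\<^bsub>M\<^esub> g \<one>\<^bsub>R\<^esub>" if "r \<in> carrier R" for r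
      proof -
        have "\<forall>s\<in>carrier R. g (r \<otimes>\<^bsub>R\<^esub> s) = r \<odot>\<^bsub>M\<^esub> g s"
          using g that by (simp add: module_Hom_def regular_module_def)
        then show ?thesis using that by (metis B.R.one_closed B.R.r_one)
      qed
      \<comment> \<open>This is \<open>compat\<close>: \<open>r x\<close> lies in \<open>?C\<close>
        exactly when \<open>r\<close> lies in \<open>?I\<close>, where \<open>g r\<close> is the
        value of \<open>h\<close> at \<open>r x\<close>.\<close>
      have "(r \<odot>\<^bsub>B\<^esub> x, r \<odot>\<^bsub>M\<^esub> g \<one>\<^bsub>R\<^esub>) \<in> G" if "r \<in> carrier R" "r \<odot>\<^bsub>B\<^esub> x \<in> ?C" for r
        using that h(2) gh[of r] g_smult[of r] by (simp add: colon_def)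
      then obtain G' where "linear_graph R B M G'" "G \<subseteq> G'" "(x, g \<one>\<^bsub>R\<^esub>) \<in> G'"
        using linear_graph_adjoin[OF G(1) x(1) g1] by blast
      then show False using max x(2) by blast
    qed
    \<comment> \<open>With \<open>?C\<close> equal to the whole carrier, the record \<open>B\<close>
      with carrier \<open>?C\<close> is \<open>B\<close> itself, so \<open>h\<close> is the required
      extension.\<close>
    then show "\<exists>g\<in>module_Hom R B M. \<forall>a\<in>A. g a = f a"
      using h_Hom h_f by (intro bexI[of _ h]) simp_all
  qed
qed

end
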